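(* For every set $I$ of non-negative integers, there exists $a\in\mathcal{A}$ such that \[\underline{d_a}(I)=\overline{d_a}(I)=\underline{d}(I),\] and thus \[\inf_{a\in\mathcal{A}}\underline{d_a}(I)=\inf_{a\in\mathcal{A}}\overline{d_a}(I)=\underline{d}(I).\]
   Context: For a sequence $a=(a_n)_{n\ge 0}$ of positive real numbers with $\sum_{n=0}^\infty a_n=\infty$ and a set $I$ of non-negative integers, define \[\overline{d_a}(I)=\limsup_{N\to\infty}\frac{\sum_{n\in[0,N]\cap I}a_n}{\sum_{n=0}^N a_n},\qquad \underline{d_a}(I)=\liminf_{N\to\infty}\frac{\sum_{n\in[0,N]\cap I}a_n}{\sum_{n=0}^N a_n}.\] The unweighted upper and lower densities $\overline{d}$, $\underline{d}$ correspond to $a_n=1$ for all $n$. $\mathcal{A}$ denotes the set of all sequences $a=(a_n)_{n\ge0}$ of positive real numbers which are decreasing (in the wide sense, i.e. $a_{n+1}\le a_n$ for all $n$), tend to $0$, and satisfy $\sum_{n=0}^\infty a_n=\infty$. *)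

theory Defs
  imports "HOL-Analysis.Analysis"
begin

definition weighted_freq :: "(nat \<Rightarrow> real) \<Rightarrow> nat set \<Rightarrow> nat \<Rightarrow> real" where
  "weighted_freq a I N = (\<Sum>n\<in>{0..N} \<inter> I. a n) / (\<Sum>n=0..N. a n)"

(* The densities are valued in ereal because limsup and liminf need a complete lattice;
   for positive weights weighted_freq stays in [0,1], so they are real numbers. *)

definition upper_wdensity :: "(nat \<Rightarrow> real) \<Rightarrow> nat set \<Rightarrow> ereal" where
  "upper_wdensity a I = limsup (\<lambda>N. ereal (weighted_freq a I N))"

definition lower_wdensity :: "(nat \<Rightarrow> real) \<Rightarrow> nat set \<Rightarrow> ereal" where
  "lower_wdensity a I = liminf (\<lambda>N. ereal (weighted_freq a I N))"

definition lower_density :: "nat set \<Rightarrow> ereal" where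
  "lower_density I = lower_wdensity (\<lambda>n. 1) I"

definition weight_class :: "(nat \<Rightarrow> real) set" where
  "weight_class = {a. (\<forall>n. 0 < a n) \<and> decseq a \<and> a \<longlonglongrightarrow> 0
     \<and> filterlim (\<lambda>N. \<Sum>n=0..N. a n) at_top sequentially}"

end

theory Submission
  imports Defs
begin

text \<open>
  Write \<open>D k\<close> for the sum of \<open>1\<^sub>I n - c\<close> over \<open>n \<le> k\<close>; its sign tells whether the plain
  frequency of \<open>I\<close> in \<open>{0..k}\<close> exceeds \<open>c\<close>. Summation by parts turns the weighted counterpart of
  \<open>D N\<close> into the sum of \<open>(a k - a (k+1)) * D k\<close> over \<open>k < N\<close>, plus \<open>a N * D N\<close>.
  For decreasing \<open>a\<close> the coefficients are nonnegative: a weighted frequency is an average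
  of plain frequencies, in which only the places \<open>k\<close> where \<open>a\<close> really drops count, apart from the
  last term. Since the total weight is unbounded, finitely many of the \<open>k\<close> do not matter. This has
  two consequences.

  The weighted lower density is never below the plain one, because for \<open>c\<close> less than the
  latter, \<open>D k\<close> is eventually nonnegative (\<open>lower_density_le_lower_wdensity\<close>).

  Conversely, let \<open>a\<close> drop only at places \<open>N j\<close> along which the plain frequency tends to its lower
  limit. Then the average sees only frequencies close to the lower density, provided that the
  last term is bounded. The value \<open>a n = 1 / (N j + 1)\<close> for \<open>N (j-1) < n \<le> N j\<close> achieves this,
  because \<open>a n * (n + 1) \<le> 1\<close> while \<open>D n\<close> grows at most linearly; and if \<open>N\<close> at least doubles in each step, every block has weight at
  least \<open>1/2\<close>, so the total weight diverges (\<open>upper_wdensity_step_weight_le\<close>).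
\<close>

section \<open>Summation by parts for decreasing weights\<close>

lemma summation_by_parts:
  fixes a f :: "nat \<Rightarrow> real"
  shows "(\<Sum>n=0..N. a n * f n) =
    (\<Sum>k<N. (a k - a (Suc k)) * (\<Sum>n=0..k. f n)) + a N * (\<Sum>n=0..N. f n)"
  by (induction N) (simp_all add: algebra_simps)

text \<open>
  The sign of the partial sums is required only where \<open>a\<close> drops, since elsewhere their
  coefficient vanishes. For the last term a lower bound suffices, because it will be divided by an
  unbounded total weight.
\<close>

lemma eventually_weighted_sum_bounded_below:
  fixes a f :: "nat \<Rightarrow> real"
  assumes "decseq a"
    and drops: "\<forall>\<^sub>F k in sequentially. a k \<noteq> a (Suc k) \<longrightarrow> 0 \<le> (\<Sum>n=0..k. f n)"
    and last: "\<forall>\<^sub>F N in sequentially. C \<le> a N * (\<Sum>n=0..N. f n)"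
  shows "\<exists>B. \<forall>\<^sub>F N in sequentially. B \<le> (\<Sum>n=0..N. a n * f n)"
proof -
  define t where "t k = (a k - a (Suc k)) * (\<Sum>n=0..k. f n)" for k
  obtain K where K: "\<And>k. k \<ge> K \<Longrightarrow> a k \<noteq> a (Suc k) \<Longrightarrow> 0 \<le> (\<Sum>n=0..k. f n)"
    using drops unfolding eventually_sequentially by blast
  have nonneg: "0 \<le> t k" if "k \<ge> K" for k
    using K[OF that] decseq_SucD[OF \<open>decseq a\<close>, of k]
    by (cases "a k = a (Suc k)") (auto simp: t_def)
  have bound: "(\<Sum>k<K. t k) + C \<le> (\<Sum>n=0..N. a n * f n)"
    if "N \<ge> K" "C \<le> a N * (\<Sum>n=0..N. f n)" for N
  proof -
    have "(\<Sum>k<K. t k) \<le> (\<Sum>k<N. t k)"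
      by (rule sum_mono2) (use that nonneg in auto)
    then show ?thesis
      using that(2) unfolding summation_by_parts t_def by linarith
  qed
  have "\<forall>\<^sub>F N in sequentially. (\<Sum>k<K. t k) + C \<le> (\<Sum>n=0..N. a n * f n)"
    using last eventually_ge_at_top[of K] by eventually_elim (rule bound)
  then show ?thesis by blast
qed

section \<open>Weighted densities from one-sided bounds on weighted sums\<close>

lemma weighted_freq_eq_sum_of_bool:
  "weighted_freq a I N = (\<Sum>n=0..N. a n * of_bool (n \<in> I)) / (\<Sum>n=0..N. a n)"
proof -
  have "(\<Sum>n\<in>{0..N} \<inter> I. a n) = (\<Sum>n=0..N. a n * of_bool (n \<in> I))"
    unfolding sum.inter_restrict[OF finite_atLeastAtMost] by (rule sum.cong) auto
  then show ?thesis by (simp add: weighted_freq_def)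
qed

lemma weighted_freq_nonneg: "(\<And>n. 0 \<le> a n) \<Longrightarrow> 0 \<le> weighted_freq a I N"
  unfolding weighted_freq_def by (simp add: sum_nonneg)

lemma lower_wdensity_le_upper_wdensity: "lower_wdensity a I \<le> upper_wdensity a I"
  unfolding lower_wdensity_def upper_wdensity_def by (simp add: Liminf_le_Limsup)

lemma tendsto_add_divide_at_top:
  fixes S :: "nat \<Rightarrow> real"
  assumes "filterlim S at_top sequentially"
  shows "(\<lambda>N. ereal (c + B / S N)) \<longlonglongrightarrow> ereal c"
proof -
  have "(\<lambda>N. B / S N) \<longlonglongrightarrow> 0"
    by (rule tendsto_divide_0[OF tendsto_const])
       (rule filterlim_at_top_imp_at_infinity[OF assms])
  from tendsto_add[OF tendsto_const this, of c] show ?thesis by simp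
qed

text \<open>
  The hypothesis says that the weighted frequency is at least \<open>c + B / A N\<close>, where \<open>A N\<close> is the
  total weight up to \<open>N\<close>; the error vanishes in the limit for any constant \<open>B\<close>, even a negative one.
  The upper bound after it is the mirror image.
\<close>

lemma le_lower_wdensityI:
  assumes "filterlim (\<lambda>N. \<Sum>n=0..N. a n) at_top sequentially"
    and "\<forall>\<^sub>F N in sequentially. B \<le> (\<Sum>n=0..N. a n * (of_bool (n \<in> I) - c))"
  shows "ereal c \<le> lower_wdensity a I"
proof -
  have "\<forall>\<^sub>F N in sequentially. 0 < (\<Sum>n=0..N. a n)"
    using assms(1) by (simp add: filterlim_at_top_dense)
  with assms(2) have
    "\<forall>\<^sub>F N in sequentially. ereal (c + B / (\<Sum>n=0..N. a n)) \<le> ereal (weighted_freq a I N)"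
    by eventually_elim
      (simp add: weighted_freq_eq_sum_of_bool divide_simps, simp add: algebra_simps
        sum_subtractf flip: sum_distrib_left)
  then have "liminf (\<lambda>N. ereal (c + B / (\<Sum>n=0..N. a n))) \<le> lower_wdensity a I"
    unfolding lower_wdensity_def by (rule Liminf_mono)
  then show ?thesis
    using lim_imp_Liminf[OF _ tendsto_add_divide_at_top[OF assms(1)], of c B] by simp
qed

lemma upper_wdensity_leI:
  assumes "filterlim (\<lambda>N. \<Sum>n=0..N. a n) at_top sequentially"
    and "\<forall>\<^sub>F N in sequentially. B \<le> (\<Sum>n=0..N. a n * (c - of_bool (n \<in> I)))"
  shows "upper_wdensity a I \<le> ereal c"
proof -
  have "\<forall>\<^sub>F N in sequentially. 0 < (\<Sum>n=0..N. a n)"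
    using assms(1) by (simp add: filterlim_at_top_dense)
  with assms(2) have
    "\<forall>\<^sub>F N in sequentially. ereal (weighted_freq a I N) \<le> ereal (c + (- B) / (\<Sum>n=0..N. a n))"
    by eventually_elim
      (simp add: weighted_freq_eq_sum_of_bool divide_simps, simp add: algebra_simps
        sum_subtractf flip: sum_distrib_left)
  then have "upper_wdensity a I \<le> limsup (\<lambda>N. ereal (c + (- B) / (\<Sum>n=0..N. a n)))"
    unfolding upper_wdensity_def by (rule Limsup_mono)
  then show ?thesis
    using lim_imp_Limsup[OF _ tendsto_add_divide_at_top[OF assms(1)], of c "- B"] by simp
qed

section \<open>The plain lower density as a lower bound\<close>

lemma weighted_freq_one:
  "weighted_freq (\<lambda>n. 1) I k = (\<Sum>n=0..k. of_bool (n \<in> I)) / real (Suc k)"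
  by (simp add: weighted_freq_eq_sum_of_bool)

lemma lower_density_le_lower_wdensity:
  assumes "a \<in> weight_class"
  shows "lower_density I \<le> lower_wdensity a I"
proof (rule dense_le)
  fix y assume "y < lower_density I"
  then obtain c where c: "y < ereal c" "ereal c < lower_density I"
    using ereal_dense2 by blast
  have a: "\<And>n. 0 < a n" "decseq a" "filterlim (\<lambda>N. \<Sum>n=0..N. a n) at_top sequentially"
    using assms by (auto simp: weight_class_def)
  have "\<forall>\<^sub>F k in sequentially. ereal c < ereal (weighted_freq (\<lambda>n. 1) I k)"
    using c(2) unfolding lower_density_def lower_wdensity_def by (rule less_LiminfD)
  then have D: "\<forall>\<^sub>F k in sequentially. 0 \<le> (\<Sum>n=0..k. of_bool (n \<in> I) - c)"
    by eventually_elim (simp add: weighted_freq_one field_simps sum_subtractf)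
  have "\<forall>\<^sub>F N in sequentially. 0 \<le> a N * (\<Sum>n=0..N. of_bool (n \<in> I) - c)"
    using D by eventually_elim (simp add: a(1) less_imp_le)
  with D have "\<exists>B. \<forall>\<^sub>F N in sequentially. B \<le> (\<Sum>n=0..N. a n * (of_bool (n \<in> I) - c))"
    by (intro eventually_weighted_sum_bounded_below[OF a(2)]) (auto elim: eventually_mono)
  then have "ereal c \<le> lower_wdensity a I"
    using le_lower_wdensityI[OF a(3)] by blast
  with c(1) show "y \<le> lower_wdensity a I" by simp
qed

section \<open>A step weight that attains the bound\<close>

definition next_in :: "nat set \<Rightarrow> nat \<Rightarrow> nat" where
  "next_in M n = (LEAST m. m \<in> M \<and> n \<le> m)"

definition step_weight :: "nat set \<Rightarrow> nat \<Rightarrow> real" where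
  "step_weight M n = 1 / real (Suc (next_in M n))"

lemma next_in:
  assumes "infinite M"
  shows "next_in M n \<in> M" "n \<le> next_in M n"
proof -
  obtain m where "m \<in> M" "n \<le> m"
    using assms unfolding infinite_nat_iff_unbounded_le by blast
  then have "next_in M n \<in> M \<and> n \<le> next_in M n"
    unfolding next_in_def by (intro LeastI[of "\<lambda>m. m \<in> M \<and> n \<le> m"]) auto
  then show "next_in M n \<in> M" "n \<le> next_in M n" by auto
qed

lemma next_in_le: "m \<in> M \<Longrightarrow> n \<le> m \<Longrightarrow> next_in M n \<le> m"
  unfolding next_in_def by (rule Least_le) simp

lemma next_in_mono:
  assumes "infinite M" "m \<le> n"
  shows "next_in M m \<le> next_in M n"
  using next_in[OF assms(1), of n] assms(2) by (intro next_in_le) auto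

lemma next_in_Suc_eq:
  assumes "infinite M" "k \<notin> M"
  shows "next_in M (Suc k) = next_in M k"
proof (rule antisym)
  have "k \<noteq> next_in M k" using next_in(1)[OF assms(1), of k] assms(2) by metis
  then show "next_in M (Suc k) \<le> next_in M k"
    using next_in[OF assms(1), of k] by (intro next_in_le) auto
qed (simp add: next_in_mono[OF assms(1)])

lemma step_weight_pos: "0 < step_weight M n"
  by (simp add: step_weight_def)

lemma decseq_step_weight: "infinite M \<Longrightarrow> decseq (step_weight M)"
  using next_in_mono[of M] by (auto simp: decseq_def step_weight_def intro!: divide_left_mono)

lemma step_weight_drop:
  "infinite M \<Longrightarrow> step_weight M k \<noteq> step_weight M (Suc k) \<Longrightarrow> k \<in> M"
  using next_in_Suc_eq[of M k] by (auto simp: step_weight_def)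

lemma step_weight_le: "infinite M \<Longrightarrow> step_weight M n \<le> 1 / real (Suc n)"
  using next_in(2)[of M n] by (auto simp: step_weight_def intro!: divide_left_mono)

text \<open>
  The block between two consecutive elements \<open>p < q\<close> has weight at least
  \<open>(q - p) / (q + 1)\<close>, and this is at least \<open>1/2\<close> exactly when \<open>2 * p + 1 \<le> q\<close>.
\<close>

lemma step_weight_sum_at_top:
  fixes N :: "nat \<Rightarrow> nat"
  assumes "strict_mono N" and doubling: "\<And>j. 2 * N j + 1 \<le> N (Suc j)"
  shows "filterlim (\<lambda>k. \<Sum>n=0..k. step_weight (range N) n) at_top sequentially"
proof -
  define S where "S k = (\<Sum>n=0..k. step_weight (range N) n)" for k
  have mono: "mono S"
    unfolding S_def mono_def
    by (auto intro!: sum_mono2 simp: less_imp_le[OF step_weight_pos])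
  have S_ge: "real j / 2 \<le> S (N j)" for j
  proof (induction j)
    case 0
    then show ?case by (simp add: S_def sum_nonneg less_imp_le[OF step_weight_pos])
  next
    case (Suc j)
    have less: "N j < N (Suc j)" using assms(1) by (simp add: strict_mono_def)
    have "S (N (Suc j)) = S (N j) + (\<Sum>n=Suc (N j)..N (Suc j). step_weight (range N) n)"
      unfolding S_def using less
        sum.ub_add_nat[of 0 "N j" "step_weight (range N)" "N (Suc j) - N j"] by simp
    moreover have "1 / 2 \<le> (\<Sum>n=Suc (N j)..N (Suc j). step_weight (range N) n)"
    proof -
      have "1 / 2 \<le> (\<Sum>n=Suc (N j)..N (Suc j). 1 / real (Suc (N (Suc j))))"
        using doubling[of j] less by (simp add: of_nat_diff field_simps)
      also have "\<dots> \<le> (\<Sum>n=Suc (N j)..N (Suc j). step_weight (range N) n)"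
        by (rule sum_mono) (auto simp: step_weight_def intro!: divide_left_mono next_in_le)
      finally show ?thesis .
    qed
    ultimately show ?case using Suc by simp
  qed
  show ?thesis
    unfolding S_def[symmetric] filterlim_at_top
  proof
    fix Z :: real
    obtain j :: nat where j: "2 * Z \<le> real j" using real_arch_simple by blast
    have "Z \<le> S k" if "k \<ge> N j" for k
      using S_ge[of j] j monoD[OF mono that] by linarith
    then show "\<forall>\<^sub>F k in sequentially. Z \<le> S k"
      unfolding eventually_sequentially by blast
  qed
qed

lemma step_weight_in_weight_class:
  fixes N :: "nat \<Rightarrow> nat"
  assumes "strict_mono N" and "\<And>j. 2 * N j + 1 \<le> N (Suc j)"
  shows "step_weight (range N) \<in> weight_class"
proof -
  have inf: "infinite (range N)"
    using assms(1) by (simp add: range_inj_infinite strict_mono_imp_inj_on)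
  have "step_weight (range N) \<longlonglongrightarrow> 0"
    by (rule tendsto_sandwich[OF _ _ tendsto_const LIMSEQ_Suc[OF lim_1_over_n]])
       (simp_all only: step_weight_le[OF inf] less_imp_le[OF step_weight_pos] eventually_True)
  then show ?thesis
    using step_weight_pos decseq_step_weight[OF inf] step_weight_sum_at_top[OF assms]
    by (simp add: weight_class_def)
qed

lemma upper_wdensity_step_weight_le:
  fixes N :: "nat \<Rightarrow> nat"
  assumes "strict_mono N" and "\<And>j. 2 * N j + 1 \<le> N (Suc j)"
    and lim: "(\<lambda>j. ereal (weighted_freq (\<lambda>n. 1) I (N j))) \<longlonglongrightarrow> d"
  shows "upper_wdensity (step_weight (range N)) I \<le> d"
proof (rule dense_ge)
  fix y assume "d < y"
  then obtain c where c: "d < ereal c" "ereal c < y"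
    using ereal_dense2 by blast
  \<comment> \<open>For \<open>c \<ge> 0\<close> every term \<open>c - 1\<^sub>I n\<close> is at least \<open>-1\<close>, which bounds the last term of the
    summation by parts.\<close>
  have "0 \<le> d"
    by (rule tendsto_lowerbound[OF lim]) (auto simp: weighted_freq_nonneg)
  then have "ereal 0 < ereal c" using c(1) by (metis order_le_less_trans zero_ereal_def)
  then have "0 \<le> c" by simp
  define a where "a = step_weight (range N)"
  have inf: "infinite (range N)"
    using assms(1) by (simp add: range_inj_infinite strict_mono_imp_inj_on)
  obtain J where J: "\<And>j. j \<ge> J \<Longrightarrow> ereal (weighted_freq (\<lambda>n. 1) I (N j)) < ereal c"
    using order_tendstoD(2)[OF lim c(1)] unfolding eventually_sequentially by blast
  have "0 \<le> (\<Sum>n=0..k. c - of_bool (n \<in> I))" if "k \<ge> N J" "a k \<noteq> a (Suc k)" for k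
  proof -
    have "k \<in> range N" using step_weight_drop[OF inf] that(2) unfolding a_def by blast
    then obtain j where j: "k = N j" by blast
    then have "j \<ge> J" using that(1) assms(1) by (simp add: strict_mono_less_eq)
    from J[OF this] show ?thesis
      unfolding j by (simp add: weighted_freq_one field_simps sum_subtractf)
  qed
  then have drops:
    "\<forall>\<^sub>F k in sequentially. a k \<noteq> a (Suc k) \<longrightarrow> 0 \<le> (\<Sum>n=0..k. c - of_bool (n \<in> I))"
    unfolding eventually_sequentially by blast
  have last: "-1 \<le> a k * (\<Sum>n=0..k. c - of_bool (n \<in> I))" for k
  proof -
    have "(\<Sum>n=0..k. - 1) \<le> (\<Sum>n=0..k. c - of_bool (n \<in> I))"
      by (rule sum_mono) (use \<open>0 \<le> c\<close> in auto)
    then have "a k * (- real (Suc k)) \<le> a k * (\<Sum>n=0..k. c - of_bool (n \<in> I))"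
      by (intro mult_left_mono) (simp_all add: a_def less_imp_le[OF step_weight_pos])
    moreover have "a k * real (Suc k) \<le> 1"
      using step_weight_le[OF inf, of k] by (simp add: a_def field_simps)
    ultimately show ?thesis unfolding mult_minus_right by linarith
  qed
  have "\<exists>B. \<forall>\<^sub>F N in sequentially. B \<le> (\<Sum>n=0..N. a n * (c - of_bool (n \<in> I)))"
    using decseq_step_weight[OF inf, folded a_def] drops always_eventually[OF allI[OF last]]
    by (rule eventually_weighted_sum_bounded_below)
  then have "upper_wdensity a I \<le> ereal c"
    using upper_wdensity_leI step_weight_sum_at_top[OF assms(1,2)] unfolding a_def by blast
  with c(2) show "upper_wdensity (step_weight (range N)) I \<le> y" by (simp add: a_def)
qed

text \<open>
  A strictly increasing \<open>r\<close> satisfies \<open>n \<le> r n\<close>, so evaluating \<open>r\<close> at the index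
  \<open>2 * r (s j) + 1\<close> is enough to pass that value.
\<close>

lemma doubling_subsequence:
  fixes r :: "nat \<Rightarrow> nat"
  assumes "strict_mono r"
  shows "\<exists>s. strict_mono s \<and> (\<forall>j. 2 * r (s j) + 1 \<le> r (s (Suc j)))"
proof -
  define s where "s = rec_nat 0 (\<lambda>_ m. 2 * r m + 1)"
  have s: "s (Suc j) = 2 * r (s j) + 1" for j by (simp add: s_def)
  have id_le: "n \<le> r n" for n by (rule strict_mono_imp_increasing[OF assms])
  have "s j < s (Suc j)" for j using id_le[of "s j"] unfolding s by linarith
  moreover have "2 * r (s j) + 1 \<le> r (s (Suc j))" for j
    using id_le[of "s (Suc j)"] by (simp add: s)
  ultimately show ?thesis by (auto simp: strict_mono_Suc_iff)
qed

lemma exists_weight_upper_wdensity_le: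
  "\<exists>a\<in>weight_class. upper_wdensity a I \<le> lower_density I"
proof -
  let ?F = "\<lambda>k. ereal (weighted_freq (\<lambda>n. 1) I k)"
  obtain r where r: "strict_mono r" "(?F \<circ> r) \<longlonglongrightarrow> lower_density I"
    using liminf_subseq_lim[of ?F] unfolding lower_density_def lower_wdensity_def by blast
  obtain s where s: "strict_mono s" "\<And>j. 2 * r (s j) + 1 \<le> r (s (Suc j))"
    using doubling_subsequence[OF r(1)] by blast
  define N where "N = r \<circ> s"
  have N: "strict_mono N" "\<And>j. 2 * N j + 1 \<le> N (Suc j)"
    using r(1) s by (auto simp: N_def strict_mono_o)
  have "(\<lambda>j. ?F (N j)) \<longlonglongrightarrow> lower_density I"
    using LIMSEQ_subseq_LIMSEQ[OF r(2) s(1)] by (simp add: N_def o_def)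
  then show ?thesis
    using upper_wdensity_step_weight_le[OF N] step_weight_in_weight_class[OF N] by blast
qed

section \<open>Attainment and infima\<close>

theorem corollary1p3:
  fixes I :: "nat set"
  shows "(\<exists>a\<in>weight_class. lower_wdensity a I = upper_wdensity a I
            \<and> upper_wdensity a I = lower_density I)
       \<and> (INF a\<in>weight_class. lower_wdensity a I) = (INF a\<in>weight_class. upper_wdensity a I)
       \<and> (INF a\<in>weight_class. upper_wdensity a I) = lower_density I"
proof -
  obtain a where a: "a \<in> weight_class" "upper_wdensity a I \<le> lower_density I"
    using exists_weight_upper_wdensity_le by blast
  have eq: "lower_wdensity a I = lower_density I" "upper_wdensity a I = lower_density I"
    using a(2) lower_density_le_lower_wdensity[OF a(1), of I]
      lower_wdensity_le_upper_wdensity[of a I] by auto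
  have "(INF a\<in>weight_class. lower_wdensity a I) = lower_density I"
    using INF_lower[OF a(1), of "\<lambda>a. lower_wdensity a I"] eq(1)
    by (intro antisym INF_greatest lower_density_le_lower_wdensity) auto
  moreover have "(INF a\<in>weight_class. upper_wdensity a I) = lower_density I"
    using INF_lower[OF a(1), of "\<lambda>a. upper_wdensity a I"] eq(2)
    by (intro antisym INF_greatest
        order_trans[OF lower_density_le_lower_wdensity lower_wdensity_le_upper_wdensity]) auto
  ultimately show ?thesis
    using a(1) eq by (intro conjI bexI[of _ a]) simp_all
qed

end
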